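(* Let $G$ be an undirected graph. Suppose that the minimum-weight dominating set problem admits a $\beta$-approximation algorithm on $G$ and the minimum edge-weighted Steiner tree problem admits a $\beta'$-approximation algorithm on $G$. Then there exists a $\beta(\beta'+1)$-approximation algorithm for the connected dominating set problem on the graph $G$ in the case where the terminal set is $T=V$.
   Context: Connected dominating set problem: given an undirected graph $G=(V,E)$, terminals $T\subseteq V$, edge lengths $l(e)\in\mathbb{R}_+$ and vertex weights $w(v)\in\mathbb{R}_+$ with $l(e)\le\min\{w(u),w(v)\}$ for every edge $e=uv$, find a tree $F\subseteq E$ and a vertex set $S\subseteq V$ such that $S$ dominates $T$ (every $t\in T$ is in $S$ or adjacent to a vertex of $S$) and $F$ spans $S$, minimizing $w(S)+\sum_{e\in F}l(e)$. The minimum-weight dominating set problem asks for a minimum-weight set $S\subseteq V$ dominating all of $V$; the edge-weighted Steiner tree problem asks for a minimum-length tree spanning a given vertex set. A $\rho$-approximation algorithm is a polynomial-time algorithm always outputting a feasible solution of value at most $\rho$ times the optimum. *)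

theory Defs
  imports Complex_Main "HOL-Library.Log_Nat" "HOL-Computational_Algebra.Polynomial"
begin

section \<open>Algorithms and running time\<close>

text \<open>
  Algorithms are programs of a WHILE language over binary trees in the style of Jones
  (\<^emph>\<open>Computability and Complexity from a Programming Perspective\<close>), whose leaves may in
  addition carry numbers. Two cost models are distinguished. In the \<^emph>\<open>logarithmic\<close> model all
  numbers are rational and are charged by their binary length; polynomial time then is
  polynomial time in the usual bit model (Turing machines). In the \<^emph>\<open>uniform\<close> model numbers
  are arbitrary reals of unit size, as on a real RAM.
\<close>

datatype cost_model = Uniform | Logarithmic

fun representable :: "cost_model \<Rightarrow> real \<Rightarrow> bool" where
  "representable Uniform x \<longleftrightarrow> True"
| "representable Logarithmic x \<longleftrightarrow> x \<in> \<rat>"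

fun num_size :: "cost_model \<Rightarrow> real \<Rightarrow> nat" where
  "num_size Uniform x = 1"
| "num_size Logarithmic x =
     (let (p, q) = quotient_of (the_inv real_of_rat x)
      in 1 + floorlog 2 (nat \<bar>p\<bar>) + floorlog 2 (nat q))"

datatype datum = Leaf | Num real | Pair datum datum

fun data_size :: "cost_model \<Rightarrow> datum \<Rightarrow> nat" where
  "data_size cm Leaf = 1"
| "data_size cm (Num x) = num_size cm x"
| "data_size cm (Pair a b) = 1 + data_size cm a + data_size cm b"

datatype expr =
    EVar nat | ELeaf | EInt int
  | EPair expr expr | EFst expr | ESnd expr | EIsPair expr | EIsNum expr
  | EAdd expr expr | ESub expr expr | EMul expr expr | EDiv expr expr | ELe expr expr

text \<open>\<^const>\<open>Leaf\<close> represents falsity; operations applied to data of the wrong shape yield \<^const>\<open>Leaf\<close>.\<close>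

definition of_truth :: "bool \<Rightarrow> datum" where
  "of_truth b = (if b then Pair Leaf Leaf else Leaf)"

fun num_op :: "(real \<Rightarrow> real \<Rightarrow> datum) \<Rightarrow> datum \<Rightarrow> datum \<Rightarrow> datum" where
  "num_op f (Num x) (Num y) = f x y"
| "num_op f _ _ = Leaf"

type_synonym store = "nat \<Rightarrow> datum"

fun eval_expr :: "expr \<Rightarrow> store \<Rightarrow> datum" where
  "eval_expr (EVar i) s = s i"
| "eval_expr ELeaf s = Leaf"
| "eval_expr (EInt k) s = Num (of_int k)"
| "eval_expr (EPair a b) s = Pair (eval_expr a s) (eval_expr b s)"
| "eval_expr (EFst a) s = (case eval_expr a s of Pair x y \<Rightarrow> x | _ \<Rightarrow> Leaf)"
| "eval_expr (ESnd a) s = (case eval_expr a s of Pair x y \<Rightarrow> y | _ \<Rightarrow> Leaf)"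
| "eval_expr (EIsPair a) s = of_truth (case eval_expr a s of Pair x y \<Rightarrow> True | _ \<Rightarrow> False)"
| "eval_expr (EIsNum a) s = of_truth (case eval_expr a s of Num x \<Rightarrow> True | _ \<Rightarrow> False)"
| "eval_expr (EAdd a b) s = num_op (\<lambda>x y. Num (x + y)) (eval_expr a s) (eval_expr b s)"
| "eval_expr (ESub a b) s = num_op (\<lambda>x y. Num (x - y)) (eval_expr a s) (eval_expr b s)"
| "eval_expr (EMul a b) s = num_op (\<lambda>x y. Num (x * y)) (eval_expr a s) (eval_expr b s)"
| "eval_expr (EDiv a b) s = num_op (\<lambda>x y. Num (x / y)) (eval_expr a s) (eval_expr b s)"
| "eval_expr (ELe a b) s = num_op (\<lambda>x y. of_truth (x \<le> y)) (eval_expr a s) (eval_expr b s)"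

text \<open>
  Every evaluation step is charged with the size of the value it produces. So the data built
  up by a computation never exceed its cost (plus the size of the input).
\<close>

fun subexprs :: "expr \<Rightarrow> expr list" where
  "subexprs (EPair a b) = [a, b]"
| "subexprs (EFst a) = [a]"
| "subexprs (ESnd a) = [a]"
| "subexprs (EIsPair a) = [a]"
| "subexprs (EIsNum a) = [a]"
| "subexprs (EAdd a b) = [a, b]"
| "subexprs (ESub a b) = [a, b]"
| "subexprs (EMul a b) = [a, b]"
| "subexprs (EDiv a b) = [a, b]"
| "subexprs (ELe a b) = [a, b]"
| "subexprs _ = []"

lemma subexprs_size [termination_simp]: "b \<in> set (subexprs a) \<Longrightarrow> size b < size a"
  by (cases a) auto

fun expr_cost :: "cost_model \<Rightarrow> expr \<Rightarrow> store \<Rightarrow> nat" where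
  "expr_cost cm a s =
     data_size cm (eval_expr a s) + (\<Sum>b\<leftarrow>subexprs a. expr_cost cm b s)"

declare expr_cost.simps [simp del]

datatype com = Skip | Assign nat expr | Seq com com | Cond expr com com | While expr com

inductive exec :: "cost_model \<Rightarrow> com \<Rightarrow> store \<Rightarrow> nat \<Rightarrow> store \<Rightarrow> bool" for cm where
  "exec cm Skip s 1 s"
| "exec cm (Assign i a) s (1 + expr_cost cm a s) (s(i := eval_expr a s))"
| "exec cm c1 s t1 s' \<Longrightarrow> exec cm c2 s' t2 s'' \<Longrightarrow> exec cm (Seq c1 c2) s (1 + t1 + t2) s''"
| "eval_expr a s \<noteq> Leaf \<Longrightarrow> exec cm c1 s t s' \<Longrightarrow>
     exec cm (Cond a c1 c2) s (1 + expr_cost cm a s + t) s'"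
| "eval_expr a s = Leaf \<Longrightarrow> exec cm c2 s t s' \<Longrightarrow>
     exec cm (Cond a c1 c2) s (1 + expr_cost cm a s + t) s'"
| "eval_expr a s = Leaf \<Longrightarrow> exec cm (While a c) s (1 + expr_cost cm a s) s"
| "eval_expr a s \<noteq> Leaf \<Longrightarrow> exec cm c s t1 s' \<Longrightarrow> exec cm (While a c) s' t2 s'' \<Longrightarrow>
     exec cm (While a c) s (1 + expr_cost cm a s + t1 + t2) s''"

text \<open>Input and output are passed in variable 0; all other variables initially hold \<^const>\<open>Leaf\<close>.\<close>

definition computes_in :: "cost_model \<Rightarrow> com \<Rightarrow> datum \<Rightarrow> nat \<Rightarrow> datum \<Rightarrow> bool" where
  "computes_in cm c d t d' \<longleftrightarrow> (\<exists>s. exec cm c ((\<lambda>_. Leaf)(0 := d)) t s \<and> s 0 = d')"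


section \<open>Minimization problems and approximation algorithms\<close>

record ('i, 's) min_problem =
  inputs :: "'i set"
  solutions :: "'i \<Rightarrow> 's set"
  objective :: "'i \<Rightarrow> 's \<Rightarrow> real"
  encode_input :: "'i \<Rightarrow> datum"
  encode_solution :: "'s \<Rightarrow> datum"

definition optimum :: "('i, 's) min_problem \<Rightarrow> 'i \<Rightarrow> real" where
  "optimum P x = (INF y\<in>solutions P x. objective P x y)"

text \<open>
  The time bound is imposed on all inputs. The output is unconstrained on those inputs (such
  as disconnected graphs) that have no feasible solution at all.
\<close>

definition approximation_algorithm ::
  "cost_model \<Rightarrow> real \<Rightarrow> ('i, 's) min_problem \<Rightarrow> com \<Rightarrow> bool" where
  "approximation_algorithm cm \<rho> P c \<longleftrightarrow>
     (\<exists>p :: nat poly. \<forall>x\<in>inputs P. \<exists>t out.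
        computes_in cm c (encode_input P x) t out \<and>
        t \<le> poly p (data_size cm (encode_input P x)) \<and>
        (solutions P x \<noteq> {} \<longrightarrow>
           (\<exists>y\<in>solutions P x. out = encode_solution P y \<and>
              objective P x y \<le> \<rho> * optimum P x)))"

definition admits_approximation :: "cost_model \<Rightarrow> real \<Rightarrow> ('i, 's) min_problem \<Rightarrow> bool" where
  "admits_approximation cm \<rho> P \<longleftrightarrow> (\<exists>c. approximation_algorithm cm \<rho> P c)"

definition restrict_inputs :: "('i, 's) min_problem \<Rightarrow> ('i \<Rightarrow> bool) \<Rightarrow> ('i, 's) min_problem" where
  "restrict_inputs P Q = P\<lparr>inputs := {x \<in> inputs P. Q x}\<rparr>"


section \<open>Graphs\<close>

type_synonym ugraph = "nat set \<times> nat set set"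

abbreviation verts :: "ugraph \<Rightarrow> nat set" where "verts G \<equiv> fst G"
abbreviation edges :: "ugraph \<Rightarrow> nat set set" where "edges G \<equiv> snd G"

definition undirected_graph :: "ugraph \<Rightarrow> bool" where
  "undirected_graph G \<longleftrightarrow> finite (verts G) \<and>
     (\<forall>e\<in>edges G. \<exists>u v. u \<in> verts G \<and> v \<in> verts G \<and> u \<noteq> v \<and> e = {u, v})"

definition is_walk :: "nat set \<Rightarrow> nat set set \<Rightarrow> nat list \<Rightarrow> bool" where
  "is_walk U F p \<longleftrightarrow> p \<noteq> [] \<and> set p \<subseteq> U \<and> (\<forall>i. Suc i < length p \<longrightarrow> {p ! i, p ! Suc i} \<in> F)"

definition is_connected :: "nat set \<Rightarrow> nat set set \<Rightarrow> bool" where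
  "is_connected U F \<longleftrightarrow> (\<forall>u\<in>U. \<forall>v\<in>U. \<exists>p. is_walk U F p \<and> hd p = u \<and> last p = v)"

definition is_cycle :: "nat set set \<Rightarrow> nat list \<Rightarrow> bool" where
  "is_cycle F p \<longleftrightarrow> 3 \<le> length p \<and> distinct p \<and>
     (\<forall>i < length p. {p ! i, p ! (Suc i mod length p)} \<in> F)"

definition is_tree :: "ugraph \<Rightarrow> bool" where
  "is_tree H \<longleftrightarrow> undirected_graph H \<and> verts H \<noteq> {} \<and>
     is_connected (verts H) (edges H) \<and> (\<nexists>p. is_cycle (edges H) p)"

text \<open>
  A tree spanning \<open>S\<close> may contain further (Steiner) vertices. The vertex set \<open>U\<close> is kept
  explicit in order to admit the one-vertex tree, which has no edges.
\<close>

definition tree_spanning :: "ugraph \<Rightarrow> nat set set \<Rightarrow> nat set \<Rightarrow> bool" where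
  "tree_spanning G F S \<longleftrightarrow> F \<subseteq> edges G \<and> (\<exists>U. S \<subseteq> U \<and> U \<subseteq> verts G \<and> is_tree (U, F))"

definition dominates :: "ugraph \<Rightarrow> nat set \<Rightarrow> nat set \<Rightarrow> bool" where
  "dominates G S T \<longleftrightarrow> (\<forall>t\<in>T. t \<in> S \<or> (\<exists>s\<in>S. {s, t} \<in> edges G))"


section \<open>Encodings\<close>

fun encode_list :: "datum list \<Rightarrow> datum" where
  "encode_list [] = Leaf"
| "encode_list (d # ds) = Pair d (encode_list ds)"

definition edge_list :: "nat set set \<Rightarrow> (nat \<times> nat) list" where
  "edge_list F = (let vs = sorted_list_of_set (\<Union>F)
     in [(u, v). u \<leftarrow> vs, v \<leftarrow> vs, u < v \<and> {u, v} \<in> F])"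

definition encode_verts :: "nat set \<Rightarrow> datum" where
  "encode_verts S = encode_list (map (\<lambda>v. Num (real v)) (sorted_list_of_set S))"

definition encode_edges :: "nat set set \<Rightarrow> datum" where
  "encode_edges F = encode_list (map (\<lambda>(u, v). Pair (Num (real u)) (Num (real v))) (edge_list F))"

definition encode_graph :: "ugraph \<Rightarrow> datum" where
  "encode_graph G = Pair (encode_verts (verts G)) (encode_edges (edges G))"

text \<open>Weights and lengths are listed in the order in which vertices and edges are encoded.\<close>

definition encode_weights :: "ugraph \<Rightarrow> (nat \<Rightarrow> real) \<Rightarrow> datum" where
  "encode_weights G w = encode_list (map (\<lambda>v. Num (w v)) (sorted_list_of_set (verts G)))"

definition encode_lengths :: "ugraph \<Rightarrow> (nat set \<Rightarrow> real) \<Rightarrow> datum" where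
  "encode_lengths G l = encode_list (map (\<lambda>(u, v). Num (l {u, v})) (edge_list (edges G)))"


section \<open>The three problems on a class of graphs\<close>

definition vertex_weights :: "cost_model \<Rightarrow> ugraph \<Rightarrow> (nat \<Rightarrow> real) \<Rightarrow> bool" where
  "vertex_weights cm G w \<longleftrightarrow> (\<forall>v\<in>verts G. 0 \<le> w v \<and> representable cm (w v))"

definition edge_lengths :: "cost_model \<Rightarrow> ugraph \<Rightarrow> (nat set \<Rightarrow> real) \<Rightarrow> bool" where
  "edge_lengths cm G l \<longleftrightarrow> (\<forall>e\<in>edges G. 0 \<le> l e \<and> representable cm (l e))"

definition dominating_set_problem ::
  "cost_model \<Rightarrow> ugraph set \<Rightarrow> (ugraph \<times> (nat \<Rightarrow> real), nat set) min_problem" where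
  "dominating_set_problem cm \<G> =
     \<lparr>inputs = {(G, w). G \<in> \<G> \<and> vertex_weights cm G w},
      solutions = (\<lambda>(G, w). {S. S \<subseteq> verts G \<and> dominates G S (verts G)}),
      objective = (\<lambda>(G, w) S. \<Sum>v\<in>S. w v),
      encode_input = (\<lambda>(G, w). Pair (encode_graph G) (encode_weights G w)),
      encode_solution = encode_verts\<rparr>"

definition steiner_tree_problem ::
  "cost_model \<Rightarrow> ugraph set \<Rightarrow>
     (ugraph \<times> nat set \<times> (nat set \<Rightarrow> real), nat set set) min_problem" where
  "steiner_tree_problem cm \<G> =
     \<lparr>inputs = {(G, T, l). G \<in> \<G> \<and> T \<subseteq> verts G \<and> edge_lengths cm G l},
      solutions = (\<lambda>(G, T, l). {F. tree_spanning G F T}),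
      objective = (\<lambda>(G, T, l) F. \<Sum>e\<in>F. l e),
      encode_input = (\<lambda>(G, T, l).
        Pair (encode_graph G) (Pair (encode_verts T) (encode_lengths G l))),
      encode_solution = encode_edges\<rparr>"

definition connected_dominating_set_problem ::
  "cost_model \<Rightarrow> ugraph set \<Rightarrow>
     (ugraph \<times> nat set \<times> (nat \<Rightarrow> real) \<times> (nat set \<Rightarrow> real), nat set \<times> nat set set) min_problem"
  where
  "connected_dominating_set_problem cm \<G> =
     \<lparr>inputs = {(G, T, w, l). G \<in> \<G> \<and> T \<subseteq> verts G \<and>
        vertex_weights cm G w \<and> edge_lengths cm G l \<and> (\<forall>e\<in>edges G. \<forall>v\<in>e. l e \<le> w v)},
      solutions = (\<lambda>(G, T, w, l).
        {(S, F). S \<subseteq> verts G \<and> dominates G S T \<and> tree_spanning G F S}),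
      objective = (\<lambda>(G, T, w, l) (S, F). (\<Sum>v\<in>S. w v) + (\<Sum>e\<in>F. l e)),
      encode_input = (\<lambda>(G, T, w, l). Pair (encode_graph G)
        (Pair (encode_verts T) (Pair (encode_weights G w) (encode_lengths G l)))),
      encode_solution = (\<lambda>(S, F). Pair (encode_verts S) (encode_edges F))\<rparr>"

end

theory Submission
  imports Defs
begin

text \<open>
  Compute an approximate dominating set \<open>S\<close> and then an approximate Steiner tree \<open>F\<close> for the
  terminal set \<open>S\<close>. If \<open>(S', F')\<close> is any solution, then each vertex of \<open>S\<close> lies in the tree
  \<open>F'\<close> or can be attached to it as a leaf by an edge to \<open>S'\<close>, which costs at most its weight.
  So \<open>S\<close> has a Steiner tree of length at most \<open>l(F') + w(S)\<close>, and the total cost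
  is at most \<open>w(S) + \<beta>' (l(F') + w(S))\<close>, where \<open>w(S) \<le> \<beta> w(S')\<close>. It remains to absorb
  \<open>\<beta>' l(F')\<close> into \<open>\<beta> (\<beta>' + 1) l(F')\<close>, for which \<open>\<beta> \<ge> 1\<close> suffices; if \<open>\<beta> < 1\<close>, unit weights
  show that all graphs of the class are empty, and the empty graph has no spanning tree.
\<close>

section \<open>Subroutine calls\<close>

fun expr_vars :: "expr \<Rightarrow> nat set" where
  "expr_vars (EVar i) = {i}"
| "expr_vars a = (\<Union>b\<in>set (subexprs a). expr_vars b)"

primrec com_vars :: "com \<Rightarrow> nat set" where
  "com_vars Skip = {}"
| "com_vars (Assign i a) = insert i (expr_vars a)"
| "com_vars (Seq c1 c2) = com_vars c1 \<union> com_vars c2"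
| "com_vars (Cond a c1 c2) = expr_vars a \<union> com_vars c1 \<union> com_vars c2"
| "com_vars (While a c) = expr_vars a \<union> com_vars c"

lemma finite_expr_vars: "finite (expr_vars a)"
  by (induction a) auto

lemma finite_com_vars: "finite (com_vars c)"
  by (induction c) (auto simp: finite_expr_vars)

lemma eval_expr_cong: "(\<And>i. i \<in> expr_vars a \<Longrightarrow> r i = s i) \<Longrightarrow> eval_expr a r = eval_expr a s"
  by (induction a) auto

text \<open>The defining equation of \<open>expr_cost\<close> matches every expression and would
  loop as a rewrite rule; one instance per constructor terminates.\<close>

lemma expr_cost_simps:
  "expr_cost cm (EVar i) s = data_size cm (s i)"
  "expr_cost cm ELeaf s = 1"
  "expr_cost cm (EInt z) s = num_size cm (of_int z)"
  "expr_cost cm (EFst a) s = data_size cm (eval_expr (EFst a) s) + expr_cost cm a s"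
  "expr_cost cm (ESnd a) s = data_size cm (eval_expr (ESnd a) s) + expr_cost cm a s"
  "expr_cost cm (EIsPair a) s = data_size cm (eval_expr (EIsPair a) s) + expr_cost cm a s"
  "expr_cost cm (EIsNum a) s = data_size cm (eval_expr (EIsNum a) s) + expr_cost cm a s"
  "expr_cost cm (EPair a b) s =
     data_size cm (eval_expr (EPair a b) s) + expr_cost cm a s + expr_cost cm b s"
  "expr_cost cm (EAdd a b) s =
     data_size cm (eval_expr (EAdd a b) s) + expr_cost cm a s + expr_cost cm b s"
  "expr_cost cm (ESub a b) s =
     data_size cm (eval_expr (ESub a b) s) + expr_cost cm a s + expr_cost cm b s"
  "expr_cost cm (EMul a b) s =
     data_size cm (eval_expr (EMul a b) s) + expr_cost cm a s + expr_cost cm b s"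
  "expr_cost cm (EDiv a b) s =
     data_size cm (eval_expr (EDiv a b) s) + expr_cost cm a s + expr_cost cm b s"
  "expr_cost cm (ELe a b) s =
     data_size cm (eval_expr (ELe a b) s) + expr_cost cm a s + expr_cost cm b s"
  by (subst expr_cost.simps; simp)+

lemma expr_cost_cong:
  assumes "\<And>i. i \<in> expr_vars a \<Longrightarrow> r i = s i"
  shows "expr_cost cm a r = expr_cost cm a s"
  using assms by (induction a) (simp_all add: expr_cost_simps eval_expr_cong[of _ r s])

text \<open>Execution reads and writes only \<open>com_vars c\<close>, so cells outside
  \<open>X\<close> keep the contents of \<open>r\<close>. This transports a run from the blank store
  of \<open>computes_in\<close> to a store holding saved data. A fixed superset \<open>X\<close>
  serves all subcommands in the induction.\<close>

lemma exec_frame: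
  assumes "exec cm c s t s'" "com_vars c \<subseteq> X" "\<And>i. i \<in> X \<Longrightarrow> r i = s i"
  shows "exec cm c r t (\<lambda>i. if i \<in> X then s' i else r i)"
  using assms
proof (induction arbitrary: r rule: exec.induct)
  case (1 s)
  then have "(\<lambda>i. if i \<in> X then s i else r i) = r" by auto
  then show ?case using exec.intros(1)[of cm r] by simp
next
  case (2 i a s)
  have "eval_expr a r = eval_expr a s" "expr_cost cm a r = expr_cost cm a s"
    by (rule eval_expr_cong expr_cost_cong; use 2 in auto)+
  moreover have "(\<lambda>j. if j \<in> X then (s(i := eval_expr a s)) j else r j) = r(i := eval_expr a s)"
    using 2 by auto
  ultimately show ?case using exec.intros(2)[of cm i a r] by simp
next
  case (3 c1 s t1 s' c2 t2 s'')
  have "exec cm c1 r t1 (\<lambda>i. if i \<in> X then s' i else r i)"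
    using 3 by simp
  moreover have "exec cm c2 (\<lambda>i. if i \<in> X then s' i else r i) t2
      (\<lambda>i. if i \<in> X then s'' i else (if i \<in> X then s' i else r i))"
    using 3 by simp
  ultimately show ?case by (auto dest: exec.intros(3) cong: if_cong)
next
  case (4 a s c1 t s' c2)
  have "eval_expr a r = eval_expr a s" and cost: "expr_cost cm a r = expr_cost cm a s"
    by (rule eval_expr_cong expr_cost_cong; use 4 in auto)+
  then have "eval_expr a r \<noteq> Leaf" using 4(1) by simp
  moreover have "exec cm c1 r t (\<lambda>i. if i \<in> X then s' i else r i)" using 4 by simp
  ultimately show ?case unfolding cost[symmetric] by (rule exec.intros)
next
  case (5 a s c2 t s' c1)
  have "eval_expr a r = eval_expr a s" and cost: "expr_cost cm a r = expr_cost cm a s"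
    by (rule eval_expr_cong expr_cost_cong; use 5 in auto)+
  then have "eval_expr a r = Leaf" using 5(1) by simp
  moreover have "exec cm c2 r t (\<lambda>i. if i \<in> X then s' i else r i)" using 5 by simp
  ultimately show ?case unfolding cost[symmetric] by (rule exec.intros)
next
  case (6 a s c)
  have "eval_expr a r = eval_expr a s" and cost: "expr_cost cm a r = expr_cost cm a s"
    by (rule eval_expr_cong expr_cost_cong; use 6 in auto)+
  then have "eval_expr a r = Leaf" using 6(1) by simp
  moreover have "(\<lambda>i. if i \<in> X then s i else r i) = r" using 6 by auto
  ultimately show ?case unfolding cost[symmetric] by (simp only: exec.intros)
next
  case (7 a s c t1 s' t2 s'')
  have "eval_expr a r = eval_expr a s" and cost: "expr_cost cm a r = expr_cost cm a s"
    by (rule eval_expr_cong expr_cost_cong; use 7 in auto)+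
  then have "eval_expr a r \<noteq> Leaf" using 7(1) by simp
  moreover have "exec cm c r t1 (\<lambda>i. if i \<in> X then s' i else r i)"
    using 7 by simp
  moreover have "exec cm (While a c) (\<lambda>i. if i \<in> X then s' i else r i) t2
      (\<lambda>i. if i \<in> X then s'' i else (if i \<in> X then s' i else r i))"
    using 7 by simp
  then have "exec cm (While a c) (\<lambda>i. if i \<in> X then s' i else r i) t2
      (\<lambda>i. if i \<in> X then s'' i else r i)"
    by (simp cong: if_cong)
  ultimately show ?case unfolding cost[symmetric] by (rule exec.intros)
qed

text \<open>The rules of \<open>exec\<close> dictate a syntactic form for time and final store; here
  both become separate equations.\<close>

lemma exec_eq: "exec cm c s t s' \<Longrightarrow> t = t' \<Longrightarrow> s' = u \<Longrightarrow> exec cm c s t' u"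
  by simp

section \<open>Data size versus running time\<close>

lemma data_size_le_expr_cost: "data_size cm (eval_expr a s) \<le> expr_cost cm a s"
  by (subst expr_cost.simps) simp

text \<open>Each assignment is charged the size of the value it stores, so a cell is either
  untouched or no larger than the time spent.\<close>

lemma exec_data_size: "exec cm c s t s' \<Longrightarrow> data_size cm (s' i) \<le> max (data_size cm (s i)) t"
proof (induction rule: exec.induct)
  case (2 j a s)
  then show ?case using data_size_le_expr_cost[of cm a s] by auto
qed auto

text \<open>Bounds an output even when it need not be correct, as for Steiner trees on an infeasible
  instance.\<close>

lemma computes_in_data_size:
  "computes_in cm c d t d' \<Longrightarrow> data_size cm d' \<le> max (data_size cm d) t"
  unfolding computes_in_def using exec_data_size[of cm c _ t _ 0] by fastforce

primrec clear :: "nat list \<Rightarrow> com" where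
  "clear [] = Skip"
| "clear (i # is) = Seq (Assign i ELeaf) (clear is)"

text \<open>Each cell costs 3: one for \<open>Seq\<close> and two for assigning a leaf of size 1.
  The final \<open>Skip\<close> adds 1.\<close>

lemma exec_clear:
  "exec cm (clear is) s (1 + 3 * length is) (\<lambda>i. if i \<in> set is then Leaf else s i)"
proof (induction "is" arbitrary: s)
  case Nil
  then show ?case by (simp add: exec.intros(1)[unfolded One_nat_def])
next
  case (Cons j js)
  have e: "exec cm (Assign j ELeaf) s 2 (s(j := Leaf))"
    by (rule exec_eq[OF exec.intros(2)]) (simp_all add: expr_cost_simps)
  show ?case
    by (simp only: clear.simps, rule exec_eq[OF exec.intros(3)[OF e Cons[of "s(j := Leaf)"]]])
      auto
qed

text \<open>The variables below \<open>k\<close> are the workspace of \<open>c\<close>; outside calls they all hold \<^const>\<open>Leaf\<close>.\<close>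

definition call :: "nat \<Rightarrow> nat \<Rightarrow> com \<Rightarrow> expr \<Rightarrow> com" where
  "call k i c a = Seq (Assign 0 a) (Seq c (Seq (Assign i (EVar 0)) (clear [0..<k])))"

lemma exec_call:
  assumes "computes_in cm c (eval_expr a s) t d" "com_vars c \<subseteq> {..<k}" "0 < k" "k \<le> i"
    and "\<And>j. j < k \<Longrightarrow> s j = Leaf"
  shows "exec cm (call k i c a) s (6 + 3 * k + expr_cost cm a s + t + data_size cm d) (s(i := d))"
proof -
  define s0 where "s0 = s(0 := eval_expr a s)"
  obtain s' where s': "exec cm c ((\<lambda>_. Leaf)(0 := eval_expr a s)) t s'" "s' 0 = d"
    using assms(1) by (auto simp: computes_in_def)
  define s1 where "s1 = (\<lambda>j. if j < k then s' j else s0 j)"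
  have e0: "exec cm (Assign 0 a) s (1 + expr_cost cm a s) s0"
    unfolding s0_def by (rule exec.intros)
  have e1: "exec cm c s0 t s1"
    using exec_frame[OF s'(1) assms(2), of s0] assms(5) by (simp add: s0_def s1_def)
  have "s1 0 = d" using s' \<open>0 < k\<close> by (simp add: s1_def)
  then have e2: "exec cm (Assign i (EVar 0)) s1 (1 + data_size cm d) (s1(i := d))"
    using exec.intros(2)[of cm i "EVar 0" s1] by (simp add: expr_cost_simps)
  have "(\<lambda>j. if j \<in> set [0..<k] then Leaf else (s1(i := d)) j) = s(i := d)"
    using assms(3-5) by (auto simp: s1_def s0_def)
  then have e3: "exec cm (clear [0..<k]) (s1(i := d)) (1 + 3 * k) (s(i := d))"
    using exec_clear[of cm "[0..<k]" "s1(i := d)"] by simp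
  show ?thesis
    unfolding call_def
    by (rule exec_eq[OF exec.intros(3)[OF e0 exec.intros(3)[OF e1 exec.intros(3)[OF e2 e3]]]])
      simp_all
qed

text \<open>Coefficients in \<open>nat\<close> have no sign. Needed because both time bounds are
  stated at the sizes of the subproblem inputs.\<close>

lemma poly_nat_mono: "m \<le> n \<Longrightarrow> poly p m \<le> poly p n" for p :: "nat poly"
  by (induction p) (auto intro: add_mono mult_mono)


section \<open>Attaching leaves to trees\<close>

lemma is_walk_mono: "is_walk U F p \<Longrightarrow> U \<subseteq> U' \<Longrightarrow> F \<subseteq> F' \<Longrightarrow> is_walk U' F' p"
  unfolding is_walk_def by blast

lemma is_walk_Cons:
  assumes "is_walk U F p" "v \<in> U" "{v, hd p} \<in> F"
  shows "is_walk U F (v # p)"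
  using assms by (auto simp: is_walk_def nth_Cons hd_conv_nth split: nat.splits)

lemma is_walk_rev:
  assumes "is_walk U F p"
  shows "is_walk U F (rev p)"
  unfolding is_walk_def
proof (intro conjI allI impI)
  fix i assume i: "Suc i < length (rev p)"
  define j where "j = length p - Suc (Suc i)"
  have "rev p ! i = p ! Suc j" "rev p ! Suc i = p ! j" "Suc j < length p"
    using i by (auto simp: rev_nth j_def Suc_diff_Suc)
  then show "{rev p ! i, rev p ! Suc i} \<in> F"
    using assms by (auto simp: is_walk_def insert_commute)
qed (use assms in \<open>auto simp: is_walk_def\<close>)

text \<open>Old walks survive; a walk from \<open>s\<close> starts with the new edge to
  \<open>u\<close>, and reversal yields walks ending in \<open>s\<close>.\<close>

lemma is_connected_insert_leaf:
  assumes "is_connected U F" "u \<in> U"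
  shows "is_connected (insert s U) (insert {s, u} F)"
proof -
  let ?U = "insert s U" and ?F = "insert {s, u} F"
  have walk: "\<exists>p. is_walk ?U ?F p \<and> hd p = x \<and> last p = y" if "x \<in> U" "y \<in> U" for x y
    using assms(1) that is_walk_mono[of U F _ ?U ?F] unfolding is_connected_def by blast
  have walk_s: "\<exists>p. is_walk ?U ?F p \<and> hd p = s \<and> last p = y" if y: "y \<in> U" for y
  proof -
    obtain p where "is_walk ?U ?F p" "hd p = u" "last p = y" using walk[OF assms(2) y] by blast
    moreover from this have "p \<noteq> []" by (simp add: is_walk_def)
    ultimately show ?thesis using is_walk_Cons[of ?U ?F p s] by (intro exI[of _ "s # p"]) auto
  qed
  have walk_s': "\<exists>p. is_walk ?U ?F p \<and> hd p = y \<and> last p = s" if y: "y \<in> U" for y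
  proof -
    obtain p where p: "is_walk ?U ?F p" "hd p = s" "last p = y" using walk_s[OF y] by blast
    then have "p \<noteq> []" by (simp add: is_walk_def)
    with p show ?thesis by (intro exI[of _ "rev p"]) (simp add: is_walk_rev hd_rev last_rev)
  qed
  have "\<exists>p. is_walk ?U ?F p \<and> hd p = s \<and> last p = s"
    by (rule exI[of _ "[s]"]) (simp add: is_walk_def)
  then show ?thesis
    unfolding is_connected_def using walk walk_s walk_s' by blast
qed

text \<open>On a cycle \<open>s\<close> would have two distinct neighbours, but its only edge leads
  to \<open>u\<close>. A cycle avoiding \<open>s\<close> cannot use the new edge and lies in
  \<open>F\<close>.\<close>

lemma acyclic_insert_leaf:
  assumes "\<nexists>p. is_cycle F p" "s \<notin> \<Union>F"
  shows "\<nexists>p. is_cycle (insert {s, u} F) p"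
proof
  assume "\<exists>p. is_cycle (insert {s, u} F) p"
  then obtain p where p: "3 \<le> length p" "distinct p"
    and e: "\<And>i. i < length p \<Longrightarrow> {p ! i, p ! (Suc i mod length p)} \<in> insert {s, u} F"
    by (auto simp: is_cycle_def)
  show False
  proof (cases "s \<in> set p")
    case False
    have "{p ! i, p ! (Suc i mod length p)} \<in> F" if "i < length p" for i
    proof -
      have "s \<noteq> p ! i" "s \<noteq> p ! (Suc i mod length p)"
        using False that by (metis nth_mem mod_less_divisor length_pos_if_in_set)+
      then have "{p ! i, p ! (Suc i mod length p)} \<noteq> {s, u}" by blast
      with e[OF that] show ?thesis by blast
    qed
    with p assms(1) show False by (auto simp: is_cycle_def)
  next
    case True
    then obtain i where i: "i < length p" "p ! i = s" by (auto simp: in_set_conv_nth)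
    \<comment> \<open>\<open>n\<close> and \<open>m\<close> are the cyclic successor and predecessor
      of \<open>i\<close>; the latter wraps explicitly because subtraction on \<open>nat\<close>
      truncates. Length at least 3 forces \<open>m \<noteq> n\<close>.\<close>
    define n where "n = Suc i mod length p"
    define m where "m = (if i = 0 then length p - 1 else i - 1)"
    have n: "n = (if Suc i = length p then 0 else Suc i)" using i by (auto simp: n_def)
    have bounds: "m < length p" "n < length p" "m \<noteq> n" "m \<noteq> i" "n \<noteq> i"
      using i p(1) by (auto simp: n m_def)
    have "Suc m mod length p = i" using i by (auto simp: m_def)
    then have "{p ! m, s} \<in> insert {s, u} F" "{s, p ! n} \<in> insert {s, u} F"
      using e[of m] e[of i] i bounds by (auto simp: n_def)
    moreover have "{p ! m, s} \<notin> F" "{s, p ! n} \<notin> F" using assms(2) by blast+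
    ultimately have "{p ! m, s} = {s, u}" "{s, p ! n} = {s, u}" by blast+
    moreover have "p ! m \<noteq> s" "p ! n \<noteq> s" "p ! m \<noteq> p ! n"
      using bounds i p(2) by (auto simp: nth_eq_iff_index_eq)
    ultimately show False by (auto simp: doubleton_eq_iff)
  qed
qed

lemma is_tree_Union_edges: "is_tree (U, F) \<Longrightarrow> \<Union>F \<subseteq> U"
  by (fastforce simp: is_tree_def undirected_graph_def)

lemma is_tree_insert_leaf:
  assumes "is_tree (U, F)" "u \<in> U" "s \<notin> U"
  shows "is_tree (insert s U, insert {s, u} F)"
proof -
  have "s \<notin> \<Union>F" using assms is_tree_Union_edges by blast
  then have "\<nexists>p. is_cycle (insert {s, u} F) p"
    using assms by (intro acyclic_insert_leaf) (auto simp: is_tree_def)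
  moreover have "is_connected (insert s U) (insert {s, u} F)"
    using assms by (intro is_connected_insert_leaf) (auto simp: is_tree_def)
  moreover have "undirected_graph (insert s U, insert {s, u} F)"
    using assms unfolding is_tree_def undirected_graph_def by fastforce
  ultimately show ?thesis by (simp add: is_tree_def)
qed

lemma finite_edges:
  assumes "undirected_graph G"
  shows "finite (edges G)"
proof (rule finite_subset)
  show "edges G \<subseteq> Pow (verts G)" using assms by (fastforce simp: undirected_graph_def)
qed (use assms in \<open>simp add: undirected_graph_def\<close>)

text \<open>Vertices of \<open>S\<close> are added one by one: one already in the tree costs
  nothing, any other is adjacent to \<open>U\<close> and becomes a leaf by an edge no longer than
  its weight. Domination refers to the original \<open>U\<close>, so it persists while the tree
  grows.\<close>

lemma extend_tree:
  fixes l :: "nat set \<Rightarrow> real"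
  assumes G: "undirected_graph G"
    and tree: "is_tree (U, F)" "U \<subseteq> verts G" "F \<subseteq> edges G"
    and S: "finite S" "S \<subseteq> verts G" "dominates G U S"
    and w: "\<And>v. v \<in> S \<Longrightarrow> 0 \<le> w v"
    and l: "\<And>e v. e \<in> edges G \<Longrightarrow> v \<in> e \<Longrightarrow> l e \<le> w v"
  shows "\<exists>U' F'. is_tree (U', F') \<and> U \<union> S \<subseteq> U' \<and> U' \<subseteq> verts G \<and> F' \<subseteq> edges G \<and>
    (\<Sum>e\<in>F'. l e) \<le> (\<Sum>e\<in>F. l e) + (\<Sum>v\<in>S. w v)"
  using S w
proof (induction S rule: finite_induct)
  case empty
  then show ?case using tree by (intro exI[of _ U] exI[of _ F]) auto
next
  case (insert s S)
  have "dominates G U S" using insert.prems by (simp add: dominates_def)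
  then obtain U' F' where IH: "is_tree (U', F')" "U \<union> S \<subseteq> U'" "U' \<subseteq> verts G" "F' \<subseteq> edges G"
    "(\<Sum>e\<in>F'. l e) \<le> (\<Sum>e\<in>F. l e) + (\<Sum>v\<in>S. w v)"
    using insert by auto
  show ?case
  proof (cases "s \<in> U'")
    case True
    moreover have "0 \<le> w s" using insert.prems by simp
    ultimately show ?thesis using IH insert.hyps by (intro exI[of _ U'] exI[of _ F']) auto
  next
    case False
    then obtain u where u: "u \<in> U" "{u, s} \<in> edges G"
      using insert.prems IH(2) by (auto simp: dominates_def)
    then have su: "{s, u} \<in> edges G" by (simp add: insert_commute)
    \<comment> \<open>No old edge meets \<open>s\<close>, so the sum over
      \<open>insert {s, u} F'\<close> splits.\<close>
    have "{s, u} \<notin> F'"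
      using is_tree_Union_edges[OF IH(1)] False by blast
    moreover have "finite F'" using IH(4) finite_edges[OF G] by (rule finite_subset)
    moreover have "l {s, u} \<le> w s" using l[OF su] by simp
    ultimately have "(\<Sum>e\<in>insert {s, u} F'. l e) \<le> (\<Sum>e\<in>F. l e) + (\<Sum>v\<in>insert s S. w v)"
      using IH(5) insert.hyps by simp
    moreover have "is_tree (insert s U', insert {s, u} F')"
      using IH False u by (intro is_tree_insert_leaf) auto
    ultimately show ?thesis
      using IH insert.prems su
      by (intro exI[of _ "insert s U'"] exI[of _ "insert {s, u} F'"]) auto
  qed
qed


section \<open>The reduction\<close>

lemma data_size_encode_list:
  "data_size cm (encode_list ds) = 1 + (\<Sum>d\<leftarrow>ds. 1 + data_size cm d)"
  by (induction ds) auto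

lemma data_size_encode_verts:
  assumes "finite S"
  shows "data_size cm (encode_verts S) = 1 + (\<Sum>v\<in>S. 1 + num_size cm (real v))"
proof -
  have "(\<Sum>v\<leftarrow>sorted_list_of_set S. 1 + num_size cm (real v)) = (\<Sum>v\<in>S. 1 + num_size cm (real v))"
    using assms by (simp add: sum_list_distinct_conv_sum_set)
  then show ?thesis by (simp add: encode_verts_def data_size_encode_list comp_def)
qed

text \<open>Keeps the Steiner instance with terminals \<open>S\<close> within the size of the input
  with terminals \<open>verts G\<close>.\<close>

lemma data_size_encode_verts_mono:
  assumes "S \<subseteq> S'" "finite S'"
  shows "data_size cm (encode_verts S) \<le> data_size cm (encode_verts S')"
  using assms finite_subset[OF assms] by (simp add: data_size_encode_verts sum_mono2)

section \<open>Optimum values and approximation ratios\<close>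

lemma optimum_le:
  assumes "y \<in> solutions P x" "\<And>z. z \<in> solutions P x \<Longrightarrow> 0 \<le> objective P x z"
  shows "optimum P x \<le> objective P x y"
  unfolding optimum_def by (rule cINF_lower) (use assms in \<open>auto intro!: bdd_belowI[of _ 0]\<close>)

text \<open>The optimum is an infimum, so \<open>a / \<rho>\<close> is compared with every solution
  and no minimizer is chosen. Feasibility matters: an infimum of no reals carries no
  information.\<close>

lemma le_mult_optimum:
  assumes "solutions P x \<noteq> {}" "0 < \<rho>" "\<And>y. y \<in> solutions P x \<Longrightarrow> a \<le> \<rho> * objective P x y"
  shows "a \<le> \<rho> * optimum P x"
proof -
  have "a / \<rho> \<le> optimum P x"
    unfolding optimum_def using assms by (intro cINF_greatest) (auto simp: field_simps)
  then show ?thesis using assms by (simp add: field_simps)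
qed

text \<open>With unit weights a dominating set of a nonempty graph costs at least 1, so the optimum
  is positive and cancels from \<open>optimum \<le> \<beta> * optimum\<close>.\<close>

lemma dominating_set_ratio_ge_1:
  assumes "admits_approximation cm \<beta> (dominating_set_problem cm \<G>)"
    and "G \<in> \<G>" "finite (verts G)" "verts G \<noteq> {}"
  shows "1 \<le> \<beta>"
proof -
  let ?P = "dominating_set_problem cm \<G>" and ?x = "(G, \<lambda>_. 1 :: real)"
  have "representable cm 1" by (cases cm) auto
  then have "?x \<in> inputs ?P" using assms by (simp add: dominating_set_problem_def vertex_weights_def)
  moreover have V: "verts G \<in> solutions ?P ?x"
    by (simp add: dominating_set_problem_def dominates_def)
  ultimately obtain S where S: "S \<in> solutions ?P ?x" "objective ?P ?x S \<le> \<beta> * optimum ?P ?x"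
    using assms(1) unfolding admits_approximation_def approximation_algorithm_def by blast
  have "1 \<le> objective ?P ?x S'" if "S' \<in> solutions ?P ?x" for S'
  proof -
    have "S' \<noteq> {}" "finite S'"
      using that assms by (auto simp: dominating_set_problem_def dominates_def intro: finite_subset)
    then have "1 \<le> card S'" by (simp add: Suc_le_eq card_gt_0_iff)
    then show ?thesis by (simp add: dominating_set_problem_def)
  qed
  then have "1 \<le> optimum ?P ?x"
    using V unfolding optimum_def by (intro cINF_greatest) auto
  moreover have "optimum ?P ?x \<le> objective ?P ?x S"
    using S(1) by (rule optimum_le) (simp add: dominating_set_problem_def)
  ultimately have "1 * optimum ?P ?x \<le> \<beta> * optimum ?P ?x" "0 < optimum ?P ?x"
    using S(2) by linarith+
  then show ?thesis by (simp only: mult_le_cancel_right_pos)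
qed

text \<open>The analysis of ratios, free of programs. The assumption on \<open>F\<close> is
  conditional because a Steiner algorithm promises nothing on infeasible instances;
  \<open>feasible\<close> discharges the condition.\<close>

lemma connected_dominating_set_bound:
  fixes cm :: cost_model and \<G> :: "ugraph set" and \<beta> \<beta>' :: real
  defines "DS \<equiv> dominating_set_problem cm \<G>" and "ST \<equiv> steiner_tree_problem cm \<G>"
    and "CD \<equiv> connected_dominating_set_problem cm \<G>"
  assumes G: "undirected_graph G" and "1 \<le> \<beta>" "0 \<le> \<beta>'"
    and x: "(G, verts G, w, l) \<in> inputs CD"
    and S: "S \<in> solutions DS (G, w)" "objective DS (G, w) S \<le> \<beta> * optimum DS (G, w)"
    and F: "solutions ST (G, S, l) \<noteq> {} \<Longrightarrow>
      F \<in> solutions ST (G, S, l) \<and> objective ST (G, S, l) F \<le> \<beta>' * optimum ST (G, S, l)"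
    and feasible: "solutions CD (G, verts G, w, l) \<noteq> {}"
  shows "(S, F) \<in> solutions CD (G, verts G, w, l) \<and>
    objective CD (G, verts G, w, l) (S, F) \<le> \<beta> * (\<beta>' + 1) * optimum CD (G, verts G, w, l)"
proof -
  note defs = DS_def ST_def CD_def dominating_set_problem_def steiner_tree_problem_def
    connected_dominating_set_problem_def
  have w: "0 \<le> w v" if "v \<in> verts G" for v
    using x that by (simp add: defs vertex_weights_def)
  have l: "0 \<le> l e" if "e \<in> edges G" for e
    using x that by (simp add: defs edge_lengths_def)
  have lw: "l e \<le> w v" if "e \<in> edges G" "v \<in> e" for e v
    using x that by (simp add: defs)
  have SV: "S \<subseteq> verts G" "dominates G S (verts G)" using S by (auto simp: defs)
  have "finite S" using SV G by (auto simp: undirected_graph_def intro: finite_subset)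
  \<comment> \<open>The tree of any solution contains \<open>S'\<close>, hence dominates
    \<open>S\<close>, and \<open>extend_tree\<close> makes it span \<open>S\<close> at an extra cost
    of at most \<open>w(S)\<close>.\<close>
  have steiner: "\<exists>F''. F'' \<in> solutions ST (G, S, l) \<and>
      objective ST (G, S, l) F'' \<le> (\<Sum>e\<in>F'. l e) + (\<Sum>v\<in>S. w v)"
    if "(S', F') \<in> solutions CD (G, verts G, w, l)" for S' F'
  proof -
    from that obtain U where U: "F' \<subseteq> edges G" "S' \<subseteq> U" "U \<subseteq> verts G" "is_tree (U, F')"
      and "dominates G S' (verts G)"
      by (auto simp: defs tree_spanning_def)
    then have "dominates G U S" using SV unfolding dominates_def by blast
    have "\<exists>U' F''. is_tree (U', F'') \<and> U \<union> S \<subseteq> U' \<and> U' \<subseteq> verts G \<and> F'' \<subseteq> edges G \<and>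
        (\<Sum>e\<in>F''. l e) \<le> (\<Sum>e\<in>F'. l e) + (\<Sum>v\<in>S. w v)"
      by (rule extend_tree[OF G U(4,3,1) \<open>finite S\<close> SV(1) \<open>dominates G U S\<close>])
        (use w lw SV(1) in auto)
    then show ?thesis unfolding defs tree_spanning_def by auto
  qed
  obtain S0 F0 where "(S0, F0) \<in> solutions CD (G, verts G, w, l)" using feasible by auto
  from steiner[OF this] have F: "F \<in> solutions ST (G, S, l)"
    "objective ST (G, S, l) F \<le> \<beta>' * optimum ST (G, S, l)" using F by auto
  have "(S, F) \<in> solutions CD (G, verts G, w, l)" using F SV by (auto simp: defs)
  moreover have "objective CD (G, verts G, w, l) (S, F) \<le>
      \<beta> * (\<beta>' + 1) * optimum CD (G, verts G, w, l)"
  proof (rule le_mult_optimum[OF feasible])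
    show "0 < \<beta> * (\<beta>' + 1)" using \<open>1 \<le> \<beta>\<close> \<open>0 \<le> \<beta>'\<close> by simp
  next
    fix y assume y: "y \<in> solutions CD (G, verts G, w, l)"
    obtain S' F' where y_eq: "y = (S', F')" by (cases y)
    obtain F'' where F'': "F'' \<in> solutions ST (G, S, l)"
      "objective ST (G, S, l) F'' \<le> (\<Sum>e\<in>F'. l e) + (\<Sum>v\<in>S. w v)"
      using steiner y y_eq by blast
    have "optimum ST (G, S, l) \<le> objective ST (G, S, l) F''"
      using F''(1) by (rule optimum_le) (auto simp: defs tree_spanning_def intro!: sum_nonneg l)
    also note F''(2)
    finally have "\<beta>' * optimum ST (G, S, l) \<le> \<beta>' * ((\<Sum>e\<in>F'. l e) + (\<Sum>v\<in>S. w v))"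
      using \<open>0 \<le> \<beta>'\<close> by (rule mult_left_mono)
    then have lF: "(\<Sum>e\<in>F. l e) \<le> \<beta>' * ((\<Sum>e\<in>F'. l e) + (\<Sum>v\<in>S. w v))"
      using F(2) by (simp add: defs)
    \<comment> \<open>As all vertices are terminals, \<open>S'\<close> dominates the whole graph and
      competes in the dominating set problem.\<close>
    have "optimum DS (G, w) \<le> objective DS (G, w) S'"
      by (rule optimum_le) (use y y_eq in \<open>auto simp: defs intro!: sum_nonneg w\<close>)
    then have "\<beta> * optimum DS (G, w) \<le> \<beta> * (\<Sum>v\<in>S'. w v)"
      using \<open>1 \<le> \<beta>\<close> by (intro mult_left_mono) (auto simp: defs)
    then have wS: "(\<Sum>v\<in>S. w v) \<le> \<beta> * (\<Sum>v\<in>S'. w v)"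
      using S(2) by (simp add: defs)
    \<comment> \<open>The key use of \<open>1 \<le> \<beta>\<close>: the factor \<beta>' of
      \<open>l(F')\<close> must not exceed the target ratio.\<close>
    have "\<beta>' \<le> 1 * (\<beta>' + 1)" by simp
    also have "\<dots> \<le> \<beta> * (\<beta>' + 1)"
      using \<open>1 \<le> \<beta>\<close> \<open>0 \<le> \<beta>'\<close> by (intro mult_right_mono) auto
    finally have "\<beta>' \<le> \<beta> * (\<beta>' + 1)" .
    moreover have "0 \<le> (\<Sum>e\<in>F'. l e)"
      using y y_eq by (auto simp: defs tree_spanning_def intro!: sum_nonneg l)
    ultimately have absorb: "\<beta>' * (\<Sum>e\<in>F'. l e) \<le> \<beta> * (\<beta>' + 1) * (\<Sum>e\<in>F'. l e)"
      by (rule mult_right_mono)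
    have "(\<Sum>v\<in>S. w v) + (\<Sum>e\<in>F. l e) \<le> (\<beta>' + 1) * (\<Sum>v\<in>S. w v) + \<beta>' * (\<Sum>e\<in>F'. l e)"
      using lF by (simp add: algebra_simps)
    also have "\<dots> \<le> (\<beta>' + 1) * (\<beta> * (\<Sum>v\<in>S'. w v)) + \<beta> * (\<beta>' + 1) * (\<Sum>e\<in>F'. l e)"
      using wS absorb \<open>0 \<le> \<beta>'\<close> by (intro add_mono mult_left_mono) auto
    also have "\<dots> = \<beta> * (\<beta>' + 1) * ((\<Sum>v\<in>S'. w v) + (\<Sum>e\<in>F'. l e))"
      by (simp add: algebra_simps)
    finally show "objective CD (G, verts G, w, l) (S, F) \<le>
        \<beta> * (\<beta>' + 1) * objective CD (G, verts G, w, l) y"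
      by (simp add: defs y_eq)
  qed
  ultimately show ?thesis by blast
qed

section \<open>The combined program and its cost\<close>

definition cds_program :: "nat \<Rightarrow> com \<Rightarrow> com \<Rightarrow> com" where
  "cds_program k c1 c2 =
     Seq (Assign k (EVar 0)) (Seq (Assign 0 ELeaf)
     (Seq (call k (k + 1) c1 (EPair (EFst (EVar k)) (EFst (ESnd (ESnd (EVar k))))))
     (Seq (call k (k + 2) c2
        (EPair (EFst (EVar k)) (EPair (EVar (k + 1)) (ESnd (ESnd (ESnd (EVar k)))))))
     (Assign 0 (EPair (EVar (k + 1)) (EVar (k + 2)))))))"

text \<open>Stated for raw data, since the cost needs only that \<open>S\<close> is no larger than
  \<open>T\<close>. The factor 4 of \<open>t2\<close> comes from running \<open>c2\<close>, copying
  its output \<open>F\<close> and charging \<open>F\<close> twice in the final pair, where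
  \<open>F\<close> has size at most \<open>n + t2\<close>.\<close>

lemma computes_in_cds_program:
  fixes cm :: cost_model and g T W L :: datum
  assumes vars: "com_vars c1 \<union> com_vars c2 \<subseteq> {..<k}" and "0 < k"
    and c1: "computes_in cm c1 (Pair g W) t1 S"
    and c2: "computes_in cm c2 (Pair g (Pair S L)) t2 F"
    and size: "data_size cm S \<le> data_size cm T"
  defines "n \<equiv> data_size cm (Pair g (Pair T (Pair W L)))"
  shows "\<exists>t. computes_in cm (cds_program k c1 c2) (Pair g (Pair T (Pair W L))) t (Pair S F) \<and>
    t \<le> t1 + 4 * t2 + 50 * n + 6 * k + 50"
proof -
  let ?d = "Pair g (Pair T (Pair W L))"
  define s1 where "s1 = (\<lambda>_. Leaf)(k := ?d)"
  define s2 where "s2 = s1(k + 1 := S)"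
  define s3 where "s3 = s2(k + 2 := F)"
  let ?a1 = "EPair (EFst (EVar k)) (EFst (ESnd (ESnd (EVar k))))"
  let ?a2 = "EPair (EFst (EVar k)) (EPair (EVar (k + 1)) (ESnd (ESnd (ESnd (EVar k)))))"
  let ?a3 = "EPair (EVar (k + 1)) (EVar (k + 2))"
  have e0: "exec cm (Assign k (EVar 0)) ((\<lambda>_. Leaf)(0 := ?d)) (1 + n)
      ((\<lambda>_. Leaf)(0 := ?d, k := ?d))"
    by (rule exec_eq[OF exec.intros(2)]) (simp_all add: expr_cost_simps n_def)
  have "((\<lambda>_. Leaf)(0 := ?d, k := ?d))(0 := Leaf) = s1"
    using \<open>0 < k\<close> by (auto simp: s1_def)
  then have e1: "exec cm (Assign 0 ELeaf) ((\<lambda>_. Leaf)(0 := ?d, k := ?d)) 2 s1"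
    by (intro exec_eq[OF exec.intros(2)]) (simp_all add: expr_cost_simps)
  have e2: "exec cm (call k (k + 1) c1 ?a1) s1
      (6 + 3 * k + expr_cost cm ?a1 s1 + t1 + data_size cm S) s2"
    unfolding s2_def using c1 vars \<open>0 < k\<close> by (intro exec_call) (auto simp: s1_def)
  have e3: "exec cm (call k (k + 2) c2 ?a2) s2
      (6 + 3 * k + expr_cost cm ?a2 s2 + t2 + data_size cm F) s3"
    unfolding s3_def using c2 vars \<open>0 < k\<close> by (intro exec_call) (auto simp: s1_def s2_def)
  have e4: "exec cm (Assign 0 ?a3) s3 (1 + expr_cost cm ?a3 s3) (s3(0 := Pair S F))"
    by (rule exec_eq[OF exec.intros(2)]) (simp_all add: s3_def s2_def)
  \<comment> \<open>The 20 collects four \<open>Seq\<close>, the constants 1, 2 and 1 of the three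
    assignments, and 6 per call.\<close>
  define t where "t = 20 + n + 6 * k + expr_cost cm ?a1 s1 + t1 + data_size cm S +
      expr_cost cm ?a2 s2 + t2 + data_size cm F + expr_cost cm ?a3 s3"
  have t: "exec cm (cds_program k c1 c2) ((\<lambda>_. Leaf)(0 := ?d)) t (s3(0 := Pair S F))"
    unfolding cds_program_def
    by (rule exec_eq[OF exec.intros(3)[OF e0 exec.intros(3)[OF e1
          exec.intros(3)[OF e2 exec.intros(3)[OF e3 e4]]]]])
      (simp_all add: t_def)
  have "expr_cost cm ?a1 s1 \<le> 10 * n"
    by (simp add: expr_cost_simps s1_def n_def)
  moreover have "expr_cost cm ?a2 s2 \<le> 12 * n"
    using size by (simp add: expr_cost_simps s1_def s2_def n_def)
  moreover have "expr_cost cm ?a3 s3 \<le> 1 + 2 * n + 2 * data_size cm F"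
    using size by (simp add: expr_cost_simps s1_def s2_def s3_def n_def)
  moreover have "data_size cm F \<le> n + t2"
    using computes_in_data_size[OF c2] size by (simp add: n_def)
  moreover have "data_size cm S \<le> n" using size by (simp add: n_def)
  ultimately have "t \<le> t1 + 4 * t2 + 50 * n + 6 * k + 50"
    by (simp add: t_def)
  moreover have "computes_in cm (cds_program k c1 c2) ?d t (Pair S F)"
    unfolding computes_in_def using t by fastforce
  ultimately show ?thesis by blast
qed

theorem theorem5:
  fixes cm :: cost_model and \<G> :: "ugraph set" and \<beta> \<beta>' :: real
  assumes "\<And>G. G \<in> \<G> \<Longrightarrow> undirected_graph G"
    and "0 \<le> \<beta>'"
    and "admits_approximation cm \<beta> (dominating_set_problem cm \<G>)"
    and "admits_approximation cm \<beta>' (steiner_tree_problem cm \<G>)"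
  shows "admits_approximation cm (\<beta> * (\<beta>' + 1))
    (restrict_inputs (connected_dominating_set_problem cm \<G>) (\<lambda>(G, T, w, l). T = verts G))"
proof -
  let ?DS = "dominating_set_problem cm \<G>" and ?ST = "steiner_tree_problem cm \<G>"
    and ?CD = "connected_dominating_set_problem cm \<G>"
  obtain c1 p1 where c1: "\<And>x. x \<in> inputs ?DS \<Longrightarrow> \<exists>t out.
      computes_in cm c1 (encode_input ?DS x) t out \<and>
      t \<le> poly p1 (data_size cm (encode_input ?DS x)) \<and>
      (solutions ?DS x \<noteq> {} \<longrightarrow> (\<exists>y\<in>solutions ?DS x. out = encode_solution ?DS y \<and>
         objective ?DS x y \<le> \<beta> * optimum ?DS x))"
    using assms(3) unfolding admits_approximation_def approximation_algorithm_def by blast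
  obtain c2 p2 where c2: "\<And>x. x \<in> inputs ?ST \<Longrightarrow> \<exists>t out.
      computes_in cm c2 (encode_input ?ST x) t out \<and>
      t \<le> poly p2 (data_size cm (encode_input ?ST x)) \<and>
      (solutions ?ST x \<noteq> {} \<longrightarrow> (\<exists>y\<in>solutions ?ST x. out = encode_solution ?ST y \<and>
         objective ?ST x y \<le> \<beta>' * optimum ?ST x))"
    using assms(4) unfolding admits_approximation_def approximation_algorithm_def by blast
  have "finite (com_vars c1 \<union> com_vars c2)" by (simp add: finite_com_vars)
  then obtain k0 where "com_vars c1 \<union> com_vars c2 \<subseteq> {..<k0}"
    using finite_nat_bounded by blast
  then have "com_vars c1 \<union> com_vars c2 \<subseteq> {..<Suc k0}" by auto
  then obtain k where k: "com_vars c1 \<union> com_vars c2 \<subseteq> {..<k}" "0 < k" by blast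
  \<comment> \<open>\<open>k\<close> depends on the two programs alone and so enters as a constant;
    the last summand is \<open>50 * n + 6 * k + 50\<close>.\<close>
  define q where "q = p1 + smult 4 p2 + [:6 * k + 50, 50:]"
  have "\<exists>t out. computes_in cm (cds_program k c1 c2) (encode_input ?CD x) t out \<and>
      t \<le> poly q (data_size cm (encode_input ?CD x)) \<and>
      (solutions ?CD x \<noteq> {} \<longrightarrow> (\<exists>y\<in>solutions ?CD x. out = encode_solution ?CD y \<and>
         objective ?CD x y \<le> \<beta> * (\<beta>' + 1) * optimum ?CD x))"
    if x_in: "x \<in> inputs ?CD" and T: "case x of (G, T, w, l) \<Rightarrow> T = verts G" for x
  proof -
    obtain G w l where x: "x = (G, verts G, w, l)" using T by (auto split: prod.splits)
    let ?n = "data_size cm (encode_input ?CD x)"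
    have G: "G \<in> \<G>" "undirected_graph G" and wl: "vertex_weights cm G w" "edge_lengths cm G l"
      using x_in x assms(1) by (auto simp: connected_dominating_set_problem_def)
    have finV: "finite (verts G)" using G(2) by (simp add: undirected_graph_def)
    \<comment> \<open>All vertices together always dominate, so the first output is certainly a
      solution; the Steiner instance may still be infeasible.\<close>
    have "verts G \<in> solutions ?DS (G, w)"
      by (simp add: dominating_set_problem_def dominates_def)
    moreover have "(G, w) \<in> inputs ?DS" using G wl by (simp add: dominating_set_problem_def)
    ultimately obtain t1 S where S: "S \<in> solutions ?DS (G, w)"
        "objective ?DS (G, w) S \<le> \<beta> * optimum ?DS (G, w)"
      and run1: "computes_in cm c1 (encode_input ?DS (G, w)) t1 (encode_solution ?DS S)"
      and t1: "t1 \<le> poly p1 (data_size cm (encode_input ?DS (G, w)))"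
      using c1[of "(G, w)"] by blast
    have SV: "S \<subseteq> verts G" using S(1) by (simp add: dominating_set_problem_def)
    then have "(G, S, l) \<in> inputs ?ST" using G wl by (simp add: steiner_tree_problem_def)
    from c2[OF this] obtain t2 out2
      where run2: "computes_in cm c2 (encode_input ?ST (G, S, l)) t2 out2"
        and t2: "t2 \<le> poly p2 (data_size cm (encode_input ?ST (G, S, l)))"
        and out2: "solutions ?ST (G, S, l) \<noteq> {} \<Longrightarrow> \<exists>F\<in>solutions ?ST (G, S, l).
          out2 = encode_solution ?ST F \<and>
          objective ?ST (G, S, l) F \<le> \<beta>' * optimum ?ST (G, S, l)"
      by blast
    have size: "data_size cm (encode_verts S) \<le> data_size cm (encode_verts (verts G))"
      using SV finV by (rule data_size_encode_verts_mono)
    obtain t where run: "computes_in cm (cds_program k c1 c2) (encode_input ?CD x) t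
        (Pair (encode_verts S) out2)"
      and t: "t \<le> t1 + 4 * t2 + 50 * ?n + 6 * k + 50"
      using computes_in_cds_program[OF k _ _ size] run1 run2
      by (fastforce simp: x dominating_set_problem_def steiner_tree_problem_def
          connected_dominating_set_problem_def)
    have "data_size cm (encode_input ?DS (G, w)) \<le> ?n"
      by (simp add: x dominating_set_problem_def connected_dominating_set_problem_def)
    then have "t1 \<le> poly p1 ?n" using t1 poly_nat_mono order_trans by blast
    moreover have "data_size cm (encode_input ?ST (G, S, l)) \<le> ?n"
      using size by (simp add: x steiner_tree_problem_def connected_dominating_set_problem_def)
    then have "t2 \<le> poly p2 ?n" using t2 poly_nat_mono order_trans by blast
    ultimately have time: "t \<le> poly q ?n" using t by (simp add: q_def)
    have "\<exists>y\<in>solutions ?CD x. Pair (encode_verts S) out2 = encode_solution ?CD y \<and>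
         objective ?CD x y \<le> \<beta> * (\<beta>' + 1) * optimum ?CD x" if ne: "solutions ?CD x \<noteq> {}"
    proof -
      \<comment> \<open>A tree has at least one vertex, so feasibility excludes the empty
        graph.\<close>
      have "verts G \<noteq> {}"
        using ne by (auto simp: x connected_dominating_set_problem_def tree_spanning_def is_tree_def)
      then have "1 \<le> \<beta>" using dominating_set_ratio_ge_1 assms(3) G(1) finV by blast
      \<comment> \<open>For an infeasible Steiner instance any \<open>F\<close> would do;
        feasibility follows once \<open>sol\<close> is known.\<close>
      obtain F where F: "solutions ?ST (G, S, l) \<noteq> {} \<Longrightarrow> F \<in> solutions ?ST (G, S, l) \<and>
          out2 = encode_solution ?ST F \<and> objective ?ST (G, S, l) F \<le> \<beta>' * optimum ?ST (G, S, l)"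
        using out2 by blast
      have sol: "(S, F) \<in> solutions ?CD x \<and>
          objective ?CD x (S, F) \<le> \<beta> * (\<beta>' + 1) * optimum ?CD x"
        unfolding x
        by (rule connected_dominating_set_bound)
          (use G \<open>1 \<le> \<beta>\<close> assms(2) ne S F x_in in \<open>auto simp: x\<close>)
      then have "F \<in> solutions ?ST (G, S, l)"
        by (simp add: x connected_dominating_set_problem_def steiner_tree_problem_def)
      then have "out2 = encode_edges F" using F by (auto simp: steiner_tree_problem_def)
      then show ?thesis
        using sol by (intro bexI[of _ "(S, F)"]) (auto simp: connected_dominating_set_problem_def)
    qed
    with run time show ?thesis by blast
  qed
  \<comment> \<open>Restricting inputs changes neither solutions nor objective; unfolding
    \<open>optimum_def\<close> lets the simplifier see this.\<close>
  then have "approximation_algorithm cm (\<beta> * (\<beta>' + 1))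
      (restrict_inputs ?CD (\<lambda>(G, T, w, l). T = verts G)) (cds_program k c1 c2)"
    unfolding approximation_algorithm_def restrict_inputs_def optimum_def
    by (intro exI[of _ q]) auto
  then show ?thesis unfolding admits_approximation_def by blast
qed

end
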